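(* Let $g:\mathbb{R}\to\mathbb{C}$ be a suitable odd function ($g(-t)=-g(t)$ for all $t$) such that $\sum_{k\in\mathbb{Z}}(k+\omega)^2|\widehat g(k+\omega)|^2$ is finite and positive for every $\omega\in[0,1]$, and let $$\delta_g(\omega)=\frac12\sqrt{\frac{\sum_{k\in\mathbb{Z}}|\widehat g(k+\omega)|^2}{\sum_{k\in\mathbb{Z}}(k+\omega)^2|\widehat g(k+\omega)|^2}},\qquad\omega\in[0,1].$$ Then $\widehat g(0)=0$, $$\sum_{k\in\mathbb{Z}}|\widehat g(k)|^2<\sum_{k\in\mathbb{Z}}k^2|\widehat g(k)|^2,$$ and hence $$\min_{\omega\in[0,1]}\delta_g(\omega)\le\delta_g(0)=\frac12\sqrt{\frac{\sum_{k\in\mathbb{Z}}|\widehat g(k)|^2}{\sum_{k\in\mathbb{Z}}k^2|\widehat g(k)|^2}}<\frac12 .$$ Thus the Wirtinger criterion is inconclusive for any Gabor system $\mathcal{G}(g,\delta\mathbb{Z}\times\mathbb{Z})$ with $\delta\ge\frac12$, i.e. it is not true that $\delta<\delta_g(\omega)$ for all $\omega\in[0,1]$. For $a,b>0$ with $ab=\delta$, this Gabor system is unitarily equivalent to $\mathcal{G}(\mathcal{D}_b^{-1}g,a\mathbb{Z}\times b\mathbb{Z})$, and $\mathcal{D}_b^{-1}g$ is again odd, since dilation preserves parity. Consequently the same limitation holds for Gabor systems with odd windows over rectangular lattices $a\mathbb{Z}\times b\mathbb{Z}$ with $ab\ge\frac12$: the Wirtinger criterion, applied after dilation to the equivalent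 system over $ab\,\mathbb{Z}\times\mathbb{Z}$, is inconclusive.
   Context: The Fourier transform is $\widehat g(\omega)=\int_{\mathbb{R}}g(t)e^{-2\pi i\omega t}\,dt$. A function $g$ is called suitable if both $g$ and $\widehat g$ belong to the Wiener space of continuous functions $W_0(\mathbb{R})$, i.e. the continuous functions $f$ with $\sum_{n\in\mathbb{Z}}\sup_{t\in[0,1]}|f(t+n)|<\infty$. The unitary dilation operator is $\mathcal{D}_b f(t)=b^{-1/2}f(t/b)$, $b>0$. For $g\in L^2(\mathbb{R})$ and discrete $\Gamma\subset\mathbb{R}^2$, the Gabor system is $\mathcal{G}(g,\Gamma)=\{M_\omega T_x g\mid(x,\omega)\in\Gamma\}$, where $T_xf(t)=f(t-x)$ and $M_\omega f(t)=e^{2\pi i\omega t}f(t)$. The Wirtinger criterion is the following sufficient condition for $\mathcal{G}(g,\delta\mathbb{Z}\times\mathbb{Z})$, $\delta>0$, to be a frame for $L^2(\mathbb{R})$: $\delta<\delta_g(\omega)$ for all $\omega\in[0,1]$, with $\delta_g$ as defined in the claim.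
   Formalization: Both strict inequalities fail for g(t)=sin(2πt) on [-1/2,1/2], 0 elsewhere (equality holds); the formal theorem proves ≤ always and < exactly when ĝ(k)≠0 for some |k|≥2. The minimum of δ_g, which need not be attained, is an infimum. *)

theory Defs
  imports "HOL-Analysis.Analysis"
begin

definition fourier :: "(real \<Rightarrow> complex) \<Rightarrow> real \<Rightarrow> complex" where
  "fourier g \<omega> = (\<integral>t. g t * exp (- (2 * pi * \<i> * \<omega> * t)) \<partial>lborel)"

text \<open>For continuous \<open>f\<close> each supremum below is over a bounded set.\<close>

definition wiener_W0 :: "(real \<Rightarrow> complex) set" where
  "wiener_W0 = {f. continuous_on UNIV f \<and>
     (\<lambda>n::int. SUP t\<in>{0..1::real}. norm (f (t + of_int n))) summable_on UNIV}"

definition suitable :: "(real \<Rightarrow> complex) \<Rightarrow> bool" where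
  "suitable g \<longleftrightarrow> g \<in> wiener_W0 \<and> fourier g \<in> wiener_W0"

definition odd_window :: "(real \<Rightarrow> complex) \<Rightarrow> bool" where
  "odd_window g \<longleftrightarrow> (\<forall>t. g (- t) = - g t)"

definition translation :: "real \<Rightarrow> (real \<Rightarrow> complex) \<Rightarrow> real \<Rightarrow> complex" where
  "translation x f = (\<lambda>t. f (t - x))"

definition modulation :: "real \<Rightarrow> (real \<Rightarrow> complex) \<Rightarrow> real \<Rightarrow> complex" where
  "modulation \<omega> f = (\<lambda>t. exp (2 * pi * \<i> * \<omega> * t) * f t)"

text \<open>For \<open>b > 0\<close> this is a bijection of the function space, so that \<open>inv (dilation b)\<close>
  is its inverse operator.\<close>

definition dilation :: "real \<Rightarrow> (real \<Rightarrow> complex) \<Rightarrow> real \<Rightarrow> complex" where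
  "dilation b f = (\<lambda>t. complex_of_real (b powr (- 1 / 2)) * f (t / b))"

definition gabor_system ::
  "(real \<Rightarrow> complex) \<Rightarrow> (real \<times> real) set \<Rightarrow> (real \<Rightarrow> complex) set" where
  "gabor_system g \<Gamma> = {modulation \<omega> (translation x g) | x \<omega>. (x, \<omega>) \<in> \<Gamma>}"

definition rect_lattice :: "real \<Rightarrow> real \<Rightarrow> (real \<times> real) set" where
  "rect_lattice a b = {(a * of_int k, b * of_int l) | k l. True}"

text \<open>Elements of $L^2(\mathbb{R})$ are handled through Borel measurable representatives;
  equality in $L^2(\mathbb{R})$ is equality almost everywhere. That a unitary operator
  respects this equality is a consequence of its linearity and preservation of inner products.\<close>

definition L2 :: "(real \<Rightarrow> complex) set" where
  "L2 = {f \<in> borel_measurable lborel. integrable lborel (\<lambda>t. (norm (f t))\<^sup>2)}"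

definition L2_inner :: "(real \<Rightarrow> complex) \<Rightarrow> (real \<Rightarrow> complex) \<Rightarrow> complex" where
  "L2_inner f h = (\<integral>t. f t * cnj (h t) \<partial>lborel)"

definition L2_eq :: "(real \<Rightarrow> complex) \<Rightarrow> (real \<Rightarrow> complex) \<Rightarrow> bool" where
  "L2_eq f h \<longleftrightarrow> (AE t in lborel. f t = h t)"

definition L2_unitary :: "((real \<Rightarrow> complex) \<Rightarrow> real \<Rightarrow> complex) \<Rightarrow> bool" where
  "L2_unitary U \<longleftrightarrow>
     (\<forall>f\<in>L2. U f \<in> L2) \<and>
     (\<forall>f\<in>L2. \<forall>h\<in>L2. \<forall>c d. L2_eq (U (\<lambda>t. c * f t + d * h t)) (\<lambda>t. c * U f t + d * U h t)) \<and>
     (\<forall>f\<in>L2. \<forall>h\<in>L2. L2_inner (U f) (U h) = L2_inner f h) \<and>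
     (\<forall>h\<in>L2. \<exists>f\<in>L2. L2_eq (U f) h)"

definition unitarily_equivalent ::
  "(real \<Rightarrow> complex) set \<Rightarrow> (real \<Rightarrow> complex) set \<Rightarrow> bool" where
  "unitarily_equivalent S T \<longleftrightarrow> S \<subseteq> L2 \<and> T \<subseteq> L2 \<and>
     (\<exists>U. L2_unitary U \<and> (\<forall>f\<in>S. \<exists>h\<in>T. L2_eq (U f) h) \<and> (\<forall>h\<in>T. \<exists>f\<in>S. L2_eq (U f) h))"

definition finite_positive_moment :: "(real \<Rightarrow> complex) \<Rightarrow> bool" where
  "finite_positive_moment g \<longleftrightarrow> (\<forall>\<omega>\<in>{0..1}.
     (\<lambda>k::int. (of_int k + \<omega>)\<^sup>2 * (norm (fourier g (of_int k + \<omega>)))\<^sup>2) summable_on UNIV \<and>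
     0 < (\<Sum>\<^sub>\<infinity>k::int. (of_int k + \<omega>)\<^sup>2 * (norm (fourier g (of_int k + \<omega>)))\<^sup>2))"

definition wirtinger_delta :: "(real \<Rightarrow> complex) \<Rightarrow> real \<Rightarrow> real" where
  "wirtinger_delta g \<omega> = 1 / 2 * sqrt (
     (\<Sum>\<^sub>\<infinity>k::int. (norm (fourier g (of_int k + \<omega>)))\<^sup>2) /
     (\<Sum>\<^sub>\<infinity>k::int. (of_int k + \<omega>)\<^sup>2 * (norm (fourier g (of_int k + \<omega>)))\<^sup>2))"

definition wirtinger_criterion :: "(real \<Rightarrow> complex) \<Rightarrow> real \<Rightarrow> bool" where
  "wirtinger_criterion g \<delta> \<longleftrightarrow> (\<forall>\<omega>\<in>{0..1}. \<delta> < wirtinger_delta g \<omega>)"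

end

theory Submission
  imports Defs
begin

text \<open>An odd window has mean zero, so at \<open>\<omega> = 0\<close> only the frequencies \<open>k\<close> with \<open>1 \<le> k\<^sup>2\<close>
  contribute and the unweighted sum is dominated by the weighted one. The dilation \<open>D\<^sub>c\<close> is
  unitary, preserves parity, and intertwines the time-frequency shift by \<open>(x, \<omega>)\<close> with that by
  \<open>(c x, \<omega> / c)\<close>, which yields both unitary equivalences.\<close>

section \<open>Energy and second moment of the transform on the integers\<close>

lemma fourier_odd_zero:
  assumes "odd_window g"
  shows "fourier g 0 = 0"
proof -
  have "fourier g 0 = (\<integral>t. g t \<partial>lborel)"
    by (simp add: fourier_def)
  \<comment> \<open>The reflection t -> -t preserves Lebesgue measure, so oddness makes the integral
    equal to its own negative.\<close>
  also have "\<dots> = (\<integral>t. g (0 + (-1) * t) \<partial>lborel)"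
    using lborel_integral_real_affine[of "-1" g 0] by simp
  also have "\<dots> = - (\<integral>t. g t \<partial>lborel)"
    using assms by (simp add: odd_window_def)
  also have "\<dots> = - fourier g 0"
    by (simp add: fourier_def)
  finally show ?thesis by simp
qed

lemma norm_le_norm_moment:
  fixes k :: int
  assumes "odd_window g"
  shows "(norm (fourier g (of_int k)))\<^sup>2 \<le> (of_int k)\<^sup>2 * (norm (fourier g (of_int k)))\<^sup>2"
proof (cases "k = 0")
  case False
  then have "1 \<le> \<bar>real_of_int k\<bar>" by linarith
  then have "1 \<le> (real_of_int k)\<^sup>2" using abs_le_square_iff[of 1 "real_of_int k"] by simp
  from mult_right_mono[OF this, of "(norm (fourier g (of_int k)))\<^sup>2"] show ?thesis by simp
qed (simp add: fourier_odd_zero[OF assms])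

lemma moment_summable:
  assumes "finite_positive_moment g"
  shows "(\<lambda>k::int. (of_int k)\<^sup>2 * (norm (fourier g (of_int k)))\<^sup>2) summable_on UNIV"
  using bspec[OF assms[unfolded finite_positive_moment_def], of 0] by simp

lemma moment_pos:
  assumes "finite_positive_moment g"
  shows "0 < (\<Sum>\<^sub>\<infinity>k::int. (of_int k)\<^sup>2 * (norm (fourier g (of_int k)))\<^sup>2)"
  using bspec[OF assms[unfolded finite_positive_moment_def], of 0] by simp

text \<open>\<open>infsum\<close> is 0 by convention on a non-summable family, so this must be known
  before the two sums can be compared.\<close>

lemma energy_summable:
  assumes "odd_window g" "finite_positive_moment g"
  shows "(\<lambda>k::int. (norm (fourier g (of_int k)))\<^sup>2) summable_on UNIV"
  by (rule summable_on_comparison_test[OF moment_summable[OF assms(2)]])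
    (simp_all add: norm_le_norm_moment[OF assms(1)])

lemma energy_le_moment:
  assumes "odd_window g" "finite_positive_moment g"
  shows "(\<Sum>\<^sub>\<infinity>k::int. (norm (fourier g (of_int k)))\<^sup>2)
      \<le> (\<Sum>\<^sub>\<infinity>k::int. (of_int k)\<^sup>2 * (norm (fourier g (of_int k)))\<^sup>2)"
  by (intro infsum_mono energy_summable moment_summable norm_le_norm_moment assms)

text \<open>The terms at |k| = 1 agree, so the strict gain has to come from a nonzero term whose
  weight k^2 exceeds 1.\<close>

lemma energy_less_moment:
  fixes k :: int
  assumes "odd_window g" "finite_positive_moment g"
    and k: "2 \<le> \<bar>k\<bar>" "fourier g (of_int k) \<noteq> 0"
  shows "(\<Sum>\<^sub>\<infinity>k::int. (norm (fourier g (of_int k)))\<^sup>2)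
      < (\<Sum>\<^sub>\<infinity>k::int. (of_int k)\<^sup>2 * (norm (fourier g (of_int k)))\<^sup>2)"
proof -
  let ?e = "\<lambda>k::int. (norm (fourier g (of_int k)))\<^sup>2"
  let ?m = "\<lambda>k::int. (of_int k)\<^sup>2 * ?e k"
  have e: "?e summable_on UNIV" and m: "?m summable_on UNIV"
    using energy_summable moment_summable assms by auto
  have "1 < \<bar>real_of_int k\<bar>" using k(1) by linarith
  then have "1 < (real_of_int k)\<^sup>2" using abs_le_square_iff[of "real_of_int k" 1] by simp
  then have "1 * ?e k < ?m k"
    by (rule mult_strict_right_mono) (use k(2) in simp)
  with has_sum_strict_mono[OF has_sum_infsum[OF e] has_sum_infsum[OF m], of k]
  show ?thesis using norm_le_norm_moment[OF assms(1)] by simp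
qed

section \<open>The Wirtinger bound at frequency 0\<close>

lemma wirtinger_delta_nonneg: "0 \<le> wirtinger_delta g \<omega>"
  unfolding wirtinger_delta_def
  by (intro mult_nonneg_nonneg real_sqrt_ge_zero divide_nonneg_nonneg infsum_nonneg) auto

lemma wirtinger_delta_0:
  "wirtinger_delta g 0 = 1 / 2 * sqrt (
      (\<Sum>\<^sub>\<infinity>k::int. (norm (fourier g (of_int k)))\<^sup>2) /
      (\<Sum>\<^sub>\<infinity>k::int. (of_int k)\<^sup>2 * (norm (fourier g (of_int k)))\<^sup>2))"
  by (simp add: wirtinger_delta_def)

lemma wirtinger_delta_0_le:
  assumes "odd_window g" "finite_positive_moment g"
  shows "wirtinger_delta g 0 \<le> 1 / 2"
  using energy_le_moment[OF assms] moment_pos[OF assms(2)]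
  by (simp add: wirtinger_delta_0)

lemma wirtinger_delta_0_less:
  fixes k :: int
  assumes "odd_window g" "finite_positive_moment g"
    and "2 \<le> \<bar>k\<bar>" "fourier g (of_int k) \<noteq> 0"
  shows "wirtinger_delta g 0 < 1 / 2"
  using energy_less_moment[OF assms] moment_pos[OF assms(2)]
  by (simp add: wirtinger_delta_0)

text \<open>The frequency 0 alone refutes the criterion. The criterion is a strict inequality, so
  the non-strict bound 1/2 suffices.\<close>

lemma not_wirtinger_criterion:
  assumes "odd_window g" "finite_positive_moment g" "1 / 2 \<le> \<delta>"
  shows "\<not> wirtinger_criterion g \<delta>"
proof
  assume "wirtinger_criterion g \<delta>"
  then have "\<delta> < wirtinger_delta g 0"
    unfolding wirtinger_criterion_def by (rule bspec) simp
  with wirtinger_delta_0_le[OF assms(1,2)] assms(3) show False by simp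
qed

section \<open>Square integrability of Wiener functions and of Gabor systems\<close>

text \<open>On each unit interval \<open>|g|\<^sup>2\<close> is at most \<open>S * s n\<close>, where \<open>s n\<close> is the local supremum
  of \<open>|g|\<close> and \<open>S\<close> the Wiener norm.\<close>

lemma wiener_W0_L2:
  assumes "g \<in> wiener_W0"
  shows "g \<in> L2"
proof -
  define s where "s n = (SUP t\<in>{0..1::real}. norm (g (t + of_int n)))" for n :: int
  have cont: "continuous_on UNIV g" and sum_s: "s summable_on UNIV"
    using assms by (auto simp: wiener_W0_def s_def[abs_def])
  have [measurable]: "g \<in> borel_measurable borel"
    by (rule borel_measurable_continuous_onI[OF cont])
  have le_s: "norm (g (t + of_int n)) \<le> s n" if "t \<in> {0..1}" for t n
    unfolding s_def
  proof (rule cSUP_upper[OF that])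
    \<comment> \<open>A real \<open>SUP\<close> bounds its members only if the set is bounded; this
      follows from continuity on a compact interval.\<close>
    have "continuous_on {0..1} (\<lambda>t. norm (g (t + real_of_int n)))"
      by (intro continuous_intros continuous_on_compose2[OF cont]) auto
    then show "bdd_above ((\<lambda>t. norm (g (t + real_of_int n))) ` {0..1})"
      by (intro bounded_imp_bdd_above compact_imp_bounded compact_continuous_image) auto
  qed
  have s_nonneg: "0 \<le> s n" for n
    using le_s[of 0 n] norm_ge_zero[of "g (0 + of_int n)"] by (simp del: norm_ge_zero)
  define S where "S = infsum s UNIV"
  have s_le: "s n \<le> S" for n
    using finite_sum_le_infsum[OF sum_s, of "{n}"] s_nonneg by (simp add: S_def)
  \<comment> \<open>Writing the integral as the mass of a density measure lets countable additivity
    split it over the intervals [n, n+1), half-open so that they are disjoint.\<close>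
  have "(\<integral>\<^sup>+t. ennreal ((norm (g t))\<^sup>2) \<partial>lborel)
      = emeasure (density lborel (\<lambda>t. ennreal ((norm (g t))\<^sup>2))) (\<Union>n::int. {of_int n..<of_int n + 1})"
  proof -
    have "(\<Union>n::int. {of_int n..<of_int n + 1 :: real}) = UNIV"
    proof (intro UNIV_eq_I[symmetric] UN_I[OF UNIV_I])
      show "x \<in> {of_int \<lfloor>x\<rfloor>..<of_int \<lfloor>x\<rfloor> + 1}" for x :: real
        by (simp add: floor_correct)
    qed
    then show ?thesis by (simp add: emeasure_density)
  qed
  also have "\<dots> = (\<integral>\<^sup>+n. emeasure (density lborel (\<lambda>t. ennreal ((norm (g t))\<^sup>2)))
      {of_int n..<of_int n + 1} \<partial>count_space (UNIV :: int set))"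
    by (rule emeasure_UN_countable) (auto simp: disjoint_family_on_def)
  also have "\<dots> \<le> (\<integral>\<^sup>+n. ennreal (S * s n) \<partial>count_space UNIV)"
  proof (rule nn_integral_mono)
    fix n :: int
    have "emeasure (density lborel (\<lambda>t. ennreal ((norm (g t))\<^sup>2))) {of_int n..<of_int n + 1}
        = (\<integral>\<^sup>+t. ennreal ((norm (g t))\<^sup>2) * indicator {of_int n..<of_int n + 1} t \<partial>lborel)"
      by (simp add: emeasure_density)
    also have "\<dots> \<le> (\<integral>\<^sup>+t. ennreal (S * s n) * indicator {of_int n..<of_int n + 1 :: real} t \<partial>lborel)"
    proof (rule nn_integral_mono)
      fix t :: real
      show "ennreal ((norm (g t))\<^sup>2) * indicator {of_int n..<of_int n + 1} t
          \<le> ennreal (S * s n) * indicator {of_int n..<of_int n + 1} t"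
      proof (cases "t \<in> {of_int n..<of_int n + 1}")
        case True
        then have le: "norm (g t) \<le> s n" using le_s[of "t - of_int n" n] by auto
        \<comment> \<open>One factor is bounded uniformly by \<open>S\<close>; the other keeps
          \<open>s n\<close>, so that the bounds remain summable over n.\<close>
        have "norm (g t) * norm (g t) \<le> S * s n"
          using le s_le[of n] s_nonneg[of n] by (intro mult_mono) auto
        then show ?thesis using True by (simp add: power2_eq_square ennreal_leI)
      qed simp
    qed
    also have "\<dots> = ennreal (S * s n)"
      by (simp add: nn_integral_cmult_indicator)
    finally show "emeasure (density lborel (\<lambda>t. ennreal ((norm (g t))\<^sup>2))) {of_int n..<of_int n + 1}
        \<le> ennreal (S * s n)" .
  qed
  also have "\<dots> < \<infinity>"
  proof -
    have "(\<lambda>n. S * s n) summable_on UNIV" by (intro summable_on_cmult_right sum_s)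
    \<comment> \<open>Summability of reals is absolute, hence integrability for counting measure,
      which gives finiteness of the nonnegative integral.\<close>
    then have "integrable (count_space UNIV) (\<lambda>n. S * s n)"
      by (simp only: summable_on_iff_abs_summable_on_real[of "\<lambda>n. S * s n"]
          abs_summable_equivalent abs_summable_on_def)
    moreover have "0 \<le> S * s n" for n
      by (rule mult_nonneg_nonneg[OF order_trans[OF s_nonneg s_le] s_nonneg])
    ultimately show ?thesis
      by (simp only: integrable_iff_bounded real_norm_def abs_of_nonneg)
  qed
  finally have "integrable lborel (\<lambda>t. (norm (g t))\<^sup>2)"
    by (intro integrableI_nonneg) auto
  then show ?thesis by (simp add: L2_def)
qed

lemma dilation_L2:
  assumes "0 < b" "f \<in> L2"
  shows "dilation b f \<in> L2"
proof -
  have [measurable]: "f \<in> borel_measurable borel" using assms(2) by (simp add: L2_def)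
  have "integrable lborel (\<lambda>t. (norm (f (0 + (1 / b) * t)))\<^sup>2)"
    using assms by (intro lborel_integrable_real_affine) (auto simp: L2_def)
  then have "integrable lborel (\<lambda>t. (b powr (- 1 / 2))\<^sup>2 * (norm (f (t / b)))\<^sup>2)"
    by simp
  then show ?thesis
    by (simp add: L2_def dilation_def norm_mult power_mult_distrib)
qed

lemma translation_L2:
  assumes "f \<in> L2"
  shows "translation x f \<in> L2"
proof -
  have [measurable]: "f \<in> borel_measurable borel" using assms by (simp add: L2_def)
  have "integrable lborel (\<lambda>t. (norm (f (- x + 1 * t)))\<^sup>2)"
    using assms by (intro lborel_integrable_real_affine) (auto simp: L2_def)
  then show ?thesis by (simp add: L2_def translation_def)
qed

lemma modulation_L2:
  assumes "f \<in> L2"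
  shows "modulation \<omega> f \<in> L2"
proof -
  have [measurable]: "f \<in> borel_measurable borel" using assms by (simp add: L2_def)
  show ?thesis using assms
    by (simp add: L2_def modulation_def norm_mult)
qed

lemma gabor_system_L2:
  assumes "f \<in> L2"
  shows "gabor_system f \<Gamma> \<subseteq> L2"
  using assms by (auto simp: gabor_system_def intro: modulation_L2 translation_L2)

section \<open>Dilation as a unitary operator and its action on Gabor systems\<close>

lemma dilation_dilation_inverse:
  assumes "0 < b"
  shows "dilation b (dilation (1 / b) f) = f"
proof
  fix t
  have "b powr (- 1 / 2) * (1 / b) powr (- 1 / 2) = 1"
    using assms by (simp flip: powr_mult)
  then have "complex_of_real (b powr (- 1 / 2)) * complex_of_real ((1 / b) powr (- 1 / 2)) = 1"
    by (metis of_real_1 of_real_mult)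
  then have "complex_of_real (b powr (- 1 / 2)) * (complex_of_real ((1 / b) powr (- 1 / 2)) * f t) = f t"
    by (metis mult.assoc mult_1)
  moreover have "t / b / (1 / b) = t" using assms by simp
  ultimately show "dilation b (dilation (1 / b) f) t = f t"
    unfolding dilation_def by metis
qed

lemma dilation_inverse_dilation:
  assumes "0 < b"
  shows "dilation (1 / b) (dilation b f) = f"
  using dilation_dilation_inverse[of "1 / b" f] assms by simp

text \<open>A two-sided inverse determines \<open>inv\<close>, which is otherwise given only by
  choice; the explicit form makes the results on \<open>dilation\<close> applicable.\<close>

lemma inv_dilation:
  assumes "0 < b"
  shows "inv (dilation b) = dilation (1 / b)"
  by (intro inv_equality dilation_dilation_inverse dilation_inverse_dilation assms)

lemma dilation_odd: "odd_window f \<Longrightarrow> odd_window (dilation b f)"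
  by (simp add: odd_window_def dilation_def)

lemma dilation_unitary:
  assumes "0 < b"
  shows "L2_unitary (dilation b)"
  unfolding L2_unitary_def
proof (intro conjI ballI allI)
  fix f h :: "real \<Rightarrow> complex"
  \<comment> \<open>The squared normalising factor is exactly the Jacobian of t -> t/b, which gives
    preservation of the inner product.\<close>
  have *: "(b powr (- 1 / 2)) * (b powr (- 1 / 2)) = 1 / b"
    using assms by (simp add: powr_minus_divide flip: powr_add)
  have "L2_inner f h = (1 / b) *\<^sub>R (\<integral>t. f (t / b) * cnj (h (t / b)) \<partial>lborel)"
    using lborel_integral_real_affine[of "1 / b" "\<lambda>t. f t * cnj (h t)" 0] assms
    by (simp add: L2_inner_def)
  also have "\<dots> = (\<integral>t. complex_of_real (1 / b) * (f (t / b) * cnj (h (t / b))) \<partial>lborel)"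
    by (simp add: scaleR_conv_of_real)
  also have "\<dots> = L2_inner (dilation b f) (dilation b h)"
    unfolding L2_inner_def dilation_def *[symmetric] by (simp add: mult_ac)
  finally show "L2_inner (dilation b f) (dilation b h) = L2_inner f h" by simp
next
  fix h assume "h \<in> L2"
  then show "\<exists>f\<in>L2. L2_eq (dilation b f) h"
    using assms by (intro bexI[of _ "dilation (1 / b) h"])
      (auto simp: L2_eq_def dilation_dilation_inverse intro: dilation_L2)
qed (simp_all add: dilation_L2[OF assms], simp add: L2_eq_def dilation_def algebra_simps)

text \<open>Evaluation at t/c divides the frequency by c, and t/c - x = (t - c x)/c multiplies the
  shift by c. No phase factor arises, so Gabor elements go exactly to Gabor elements.\<close>

lemma dilation_time_frequency_shift:
  assumes "0 < c"
  shows "dilation c (modulation \<omega> (translation x f))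
    = modulation (\<omega> / c) (translation (c * x) (dilation c f))"
  using assms by (auto simp: dilation_def modulation_def translation_def fun_eq_iff diff_divide_distrib)

text \<open>The product of the two lattice parameters is preserved, so dilation can normalise the
  frequency step to 1 without changing a b.\<close>

lemma dilation_gabor_system:
  assumes "0 < c"
  shows "dilation c ` gabor_system f (rect_lattice a b)
    = gabor_system (dilation c f) (rect_lattice (c * a) (b / c))"
proof -
  have "gabor_system f (rect_lattice a b)
      = (\<lambda>(k, l). modulation (b * of_int l) (translation (a * of_int k) f)) ` UNIV" for f a b
    by (auto simp: gabor_system_def rect_lattice_def)
  then show ?thesis
    using assms by (simp add: image_image case_prod_unfold dilation_time_frequency_shift mult.assoc)
qed

lemma gabor_system_unitarily_equivalent:
  assumes "0 < c" "f \<in> L2"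
  shows "unitarily_equivalent (gabor_system f (rect_lattice a b))
    (gabor_system (dilation c f) (rect_lattice (c * a) (b / c)))"
  unfolding unitarily_equivalent_def
  by (intro conjI exI[of _ "dilation c"] gabor_system_L2 dilation_L2 dilation_unitary assms)
    (auto simp: L2_eq_def simp flip: dilation_gabor_system[OF assms(1)])

text \<open>Strictness is conditional: if the transform vanishes at every integer other than 1 and
  -1, both sums agree term by term and \<open>wirtinger_delta g 0\<close> equals 1/2. Failure of the
  criterion for \<delta> \<ge> 1/2 does not depend on strictness.\<close>

theorem mainTheorem2:
  fixes g :: "real \<Rightarrow> complex"
  assumes "suitable g" and "odd_window g" and "finite_positive_moment g"
  shows "fourier g 0 = 0 \<and>
    (\<Sum>\<^sub>\<infinity>k::int. (norm (fourier g (of_int k)))\<^sup>2)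
      \<le> (\<Sum>\<^sub>\<infinity>k::int. (of_int k)\<^sup>2 * (norm (fourier g (of_int k)))\<^sup>2) \<and>
    ((\<exists>k::int. 2 \<le> \<bar>k\<bar> \<and> fourier g (of_int k) \<noteq> 0) \<longrightarrow>
      (\<Sum>\<^sub>\<infinity>k::int. (norm (fourier g (of_int k)))\<^sup>2)
      < (\<Sum>\<^sub>\<infinity>k::int. (of_int k)\<^sup>2 * (norm (fourier g (of_int k)))\<^sup>2)) \<and>
    (INF \<omega>\<in>{0..1}. wirtinger_delta g \<omega>) \<le> wirtinger_delta g 0 \<and>
    wirtinger_delta g 0 = 1 / 2 * sqrt (
      (\<Sum>\<^sub>\<infinity>k::int. (norm (fourier g (of_int k)))\<^sup>2) /
      (\<Sum>\<^sub>\<infinity>k::int. (of_int k)\<^sup>2 * (norm (fourier g (of_int k)))\<^sup>2)) \<and>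
    wirtinger_delta g 0 \<le> 1 / 2 \<and>
    ((\<exists>k::int. 2 \<le> \<bar>k\<bar> \<and> fourier g (of_int k) \<noteq> 0) \<longrightarrow> wirtinger_delta g 0 < 1 / 2) \<and>
    (\<forall>\<delta>\<ge>1 / 2. \<not> wirtinger_criterion g \<delta>) \<and>
    (\<forall>a>0. \<forall>b>0.
      unitarily_equivalent (gabor_system g (rect_lattice (a * b) 1))
        (gabor_system (inv (dilation b) g) (rect_lattice a b)) \<and>
      odd_window (inv (dilation b) g)) \<and>
    (\<forall>h. \<forall>a>0. \<forall>b>0. odd_window h \<longrightarrow> suitable (dilation b h) \<longrightarrow>
      finite_positive_moment (dilation b h) \<longrightarrow> 1 / 2 \<le> a * b \<longrightarrow>
      unitarily_equivalent (gabor_system h (rect_lattice a b))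
        (gabor_system (dilation b h) (rect_lattice (a * b) 1)) \<and>
      \<not> wirtinger_criterion (dilation b h) (a * b))"
proof (intro conjI allI impI)
  show "(INF \<omega>\<in>{0..1}. wirtinger_delta g \<omega>) \<le> wirtinger_delta g 0"
    \<comment> \<open>Nonnegativity bounds the family below, as the real infimum requires.\<close>
    by (rule cINF_lower) (auto intro: bdd_belowI2 wirtinger_delta_nonneg)
next
  fix a b :: real
  assume "0 < a" "0 < b"
  have "g \<in> L2" using assms(1) by (auto simp: suitable_def intro: wiener_W0_L2)
  \<comment> \<open>The factor c = 1/b sends the parameters (a b, 1) to (a, b).\<close>
  from gabor_system_unitarily_equivalent[OF _ this, of "1 / b" "a * b" 1] \<open>0 < b\<close>
  show "unitarily_equivalent (gabor_system g (rect_lattice (a * b) 1))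
      (gabor_system (inv (dilation b) g) (rect_lattice a b))"
    by (simp add: inv_dilation)
  show "odd_window (inv (dilation b) g)"
    using assms(2) \<open>0 < b\<close> by (simp add: inv_dilation dilation_odd)
next
  fix h :: "real \<Rightarrow> complex" and a b :: real
  assume "0 < a" "0 < b" "odd_window h" and s: "suitable (dilation b h)"
    and f: "finite_positive_moment (dilation b h)" and "1 / 2 \<le> a * b"
  show "\<not> wirtinger_criterion (dilation b h) (a * b)"
    by (intro not_wirtinger_criterion dilation_odd) fact+
  have "dilation b h \<in> L2" using s by (auto simp: suitable_def intro: wiener_W0_L2)
  \<comment> \<open>Suitability is given for the dilated window only; undoing the dilation carries
    square integrability back to \<open>h\<close>.\<close>
  then have "dilation (1 / b) (dilation b h) \<in> L2"
    using \<open>0 < b\<close> dilation_L2[of "1 / b"] by simp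
  then have "h \<in> L2" using \<open>0 < b\<close> by (simp only: dilation_inverse_dilation)
  \<comment> \<open>Here c = b, which sends (a, b) to (a b, 1).\<close>
  from gabor_system_unitarily_equivalent[OF \<open>0 < b\<close> this, of a b] \<open>0 < b\<close>
  show "unitarily_equivalent (gabor_system h (rect_lattice a b))
      (gabor_system (dilation b h) (rect_lattice (a * b) 1))"
    by (simp add: mult.commute)
qed (use assms(2,3) in \<open>auto simp only: intro: fourier_odd_zero energy_le_moment energy_less_moment
    wirtinger_delta_0 wirtinger_delta_0_le wirtinger_delta_0_less
    not_wirtinger_criterion[THEN notE]\<close>)

end
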